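(* Let $\mathcal{X}\subset\mathbb{R}^n$, let $\psi(x,\xi)$ be real-valued and differentiable in $x$, set $\psi(x)=\mathbb{E}[\psi(x,\xi)]$, let $\tilde\phi$ be a smoothing function of $\phi:\mathbb{R}\to\mathbb{R}$, and set $\tilde f(x,\mu)=\tilde\phi(\psi(x),\mu)$. Suppose there are constants $G_1,G_2>0$ such that $$\mathbb{E}[\|\nabla_x\psi(x,\xi)\|^2]\le G_1^2\ \text{ for all }x\in\mathcal{X},\qquad \mathbb{E}[\tilde\phi'(\psi(x,\xi),\mu)^2]\le\left(\frac{G_2}{\mu}\right)^2\ \text{ for all }x\in\mathcal{X},\ \mu>0.$$ Let $\tilde\phi'(t,\mu)$ be a linear function of $t$. Let $\xi^1,\xi^2$ be independent samples of $\xi$, and assume unbiasedness of $\psi(x,\xi^1)$ and $\nabla_x\psi(x,\xi^2)$, i.e. $\mathbb{E}[\psi(x,\xi^1)]=\psi(x)$ and $\mathbb{E}[\nabla_x\psi(x,\xi^2)]=\nabla\psi(x)$. Then $\nabla_x\tilde f(x,\xi^1,\xi^2,\mu)=\tilde\phi'(\psi(x,\xi^1),\mu)\nabla_x\psi(x,\xi^2)$ is an unbiased stochastic estimator of $\nabla_x\tilde f(x,\mu)$, that is, for all $x\in\mathcal{X}$ and $\mu>0$, $$\nabla_x\tilde f(x,\mu)=\mathbb{E}\left[\tilde\phi'(\psi(x,\xi^1),\mu)\nabla_x\psi(x,\xi^2)\right].$$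
   Context: The setting is the compositional objective $f(x)=\phi(\mathbb{E}[\psi(x,\xi)])$, with $\xi$ a random vector, $\psi(\cdot)=\mathbb{E}[\psi(\cdot,\xi)]$ differentiable and $\phi:\mathbb{R}\to\mathbb{R}$ locally Lipschitz and possibly non-smooth. A smoothing function of $\phi$ is a function $\tilde\phi:\mathbb{R}\times[0,+\infty)\to\mathbb{R}$ such that $\tilde\phi(\cdot,\mu)$ is continuously differentiable for each $\mu>0$ and $\lim_{z\to t,\,\mu\downarrow0}\tilde\phi(z,\mu)=\phi(t)$ for all $t$. $\tilde\phi'(\cdot,\mu)$ denotes the derivative of $\tilde\phi(\cdot,\mu)$ with respect to its first argument, so that $\nabla_x\tilde f(x,\mu)=\tilde\phi'(\psi(x),\mu)\nabla\psi(x)$. *)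

theory Defs
  imports "HOL-Probability.Probability"
begin

(* Meaningful only where f is differentiable; elsewhere the value is unspecified. *)
definition gradient :: "('a::real_inner \<Rightarrow> real) \<Rightarrow> 'a \<Rightarrow> 'a"
  where "gradient f x = (THE D. GDERIV f x :> D)"

(* local_lipschitz concerns parameter-dependent families; here the family is constant. *)
definition locally_lipschitz :: "('a::metric_space \<Rightarrow> 'b::metric_space) \<Rightarrow> bool"
  where "locally_lipschitz f \<longleftrightarrow> local_lipschitz (UNIV :: real set) UNIV (\<lambda>_. f)"

(* The second argument of \<phi>s is the smoothing parameter, with intended domain [0, \<infinity>); values
   at negative parameters are irrelevant.  The filter nhds t (not at t) allows z = t in the
   joint limit z \<rightarrow> t, \<mu> \<down> 0. *)
definition smoothing_function :: "(real \<Rightarrow> real \<Rightarrow> real) \<Rightarrow> (real \<Rightarrow> real) \<Rightarrow> bool"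
  where "smoothing_function \<phi>s \<phi> \<longleftrightarrow>
    (\<forall>\<mu>>0. (\<lambda>t. \<phi>s t \<mu>) C1_differentiable_on UNIV) \<and>
    (\<forall>t. ((\<lambda>(z, \<mu>). \<phi>s z \<mu>) \<longlongrightarrow> \<phi> t) (nhds t \<times>\<^sub>F at_right 0))"

(* The Bochner integral of a non-integrable function is 0 by convention, so integrability
   is part of the notion. *)
definition unbiased_estimator ::
    "'w measure \<Rightarrow> ('w \<Rightarrow> 'b::{banach, second_countable_topology}) \<Rightarrow> 'b \<Rightarrow> bool"
  where "unbiased_estimator M T \<theta> \<longleftrightarrow> integrable M T \<and> (\<integral>\<omega>. T \<omega> \<partial>M) = \<theta>"

definition independent_samples ::
    "'w measure \<Rightarrow> ('w \<Rightarrow> 'b::topological_space) \<Rightarrow> ('w \<Rightarrow> 'b) \<Rightarrow> ('w \<Rightarrow> 'b) \<Rightarrow> bool"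
  where "independent_samples M \<xi> \<xi>1 \<xi>2 \<longleftrightarrow>
    distr M borel \<xi>1 = distr M borel \<xi> \<and>
    distr M borel \<xi>2 = distr M borel \<xi> \<and>
    prob_space.indep_var M borel \<xi>1 borel \<xi>2"

end

theory Submission
  imports Defs
begin

text \<open>As the derivative of \<open>\<phi>s\<close> is affine in its first argument, it commutes with the expectation of
\<open>\<psi> x (\<xi>1 \<omega>)\<close>; the two factors of the estimator are independent, so the expectation of their
product is the product of their expectations, and the chain rule identifies the result with the
gradient of \<open>fs\<close>.\<close>

text \<open>Two candidate vectors represent the same derivative at \<open>x\<close>, and an inner
  product determines its representing vector; so the definite description in \<open>gradient\<close>
  is well defined.\<close>

lemma gradient_eqI:
  assumes "GDERIV f x :> D"
  shows "gradient f x = D"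
proof -
  have "D' = D" if "GDERIV f x :> D'" for D'
  proof -
    have "(\<lambda>h. h \<bullet> D') = (\<lambda>h. h \<bullet> D)"
      using that assms unfolding gderiv_def by (rule has_derivative_unique)
    then show ?thesis
      by (metis inner_commute vector_eq_ldot)
  qed
  with assms show ?thesis
    unfolding gradient_def by (intro the_equality)
qed

text \<open>Riesz representation in finite dimension: every linear functional on a Euclidean space
  is the inner product with some vector, so differentiability already yields a gradient.\<close>

lemma GDERIV_gradient:
  fixes f :: "'a::euclidean_space \<Rightarrow> real"
  assumes "f differentiable (at x)"
  shows "GDERIV f x :> gradient f x"
proof -
  obtain f' where f': "(f has_derivative f') (at x)"
    using assms unfolding differentiable_def by blast
  interpret linear f'
    using f' by (rule has_derivative_linear)
  \<comment> \<open>The coordinates of the representing vector are the values of the functional on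
    the basis.\<close>
  define D where "D = (\<Sum>b\<in>Basis. f' b *\<^sub>R b)"
  have "f' h = h \<bullet> D" for h
  proof -
    have "f' h = f' (\<Sum>b\<in>Basis. (h \<bullet> b) *\<^sub>R b)"
      by (simp add: euclidean_representation)
    also have "\<dots> = h \<bullet> D"
      unfolding D_def by (simp add: sum scaleR inner_sum_right mult.commute)
    finally show ?thesis .
  qed
  then have "GDERIV f x :> D"
    using f' unfolding gderiv_def by presburger
  then show ?thesis
    by (simp add: gradient_eqI)
qed

text \<open>Writes a directional derivative as the limit of a sequence rather than along a filter on
  the reals, because measurability passes to pointwise limits of sequences.\<close>

lemma GDERIV_difference_quotient:
  fixes f :: "'a::real_inner \<Rightarrow> real"
  assumes "GDERIV f x :> D"
  shows "(\<lambda>n. (f (x + inverse (real (Suc n)) *\<^sub>R v) - f x) * real (Suc n)) \<longlonglongrightarrow> D \<bullet> v"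
proof -
  \<comment> \<open>Restricting \<open>f\<close> to the line through \<open>x\<close> in direction
    \<open>v\<close> reduces the claim to a derivative in one real variable.\<close>
  have "((\<lambda>t. f (x + t *\<^sub>R v)) has_derivative (\<lambda>t. (t *\<^sub>R v) \<bullet> D)) (at 0)"
    by (rule has_derivative_compose[where f = "\<lambda>t. x + t *\<^sub>R v" and g = f])
      (use assms in \<open>auto simp: gderiv_def intro!: derivative_eq_intros\<close>)
  then have "DERIV (\<lambda>t. f (x + t *\<^sub>R v)) 0 :> D \<bullet> v"
    unfolding has_field_derivative_def by (simp add: inner_commute mult_commute_abs)
  then have lim: "((\<lambda>t. (f (x + t *\<^sub>R v) - f x) / t) \<longlongrightarrow> D \<bullet> v) (at 0)"
    by (simp add: DERIV_def)
  \<comment> \<open>\<open>Suc n\<close> keeps every step size finite and nonzero; the latter is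
    what the punctured filter \<open>at 0\<close> demands.\<close>
  have "filterlim (\<lambda>n. inverse (real (Suc n))) (at 0) sequentially"
    by (intro filterlim_atI LIMSEQ_inverse_real_of_nat) simp
  from filterlim_compose[OF lim this] show ?thesis
    by (simp add: divide_inverse)
qed

text \<open>The definite description in \<open>gradient\<close> says nothing about measurability in
  the parameter. Each coordinate, however, is a pointwise limit of difference quotients, which are
  measurable because every \<open>f x\<close> is.\<close>

lemma borel_measurable_gradient:
  fixes f :: "'a::euclidean_space \<Rightarrow> 'b \<Rightarrow> real"
  assumes meas: "\<And>x. f x \<in> borel_measurable N"
    and diff: "\<And>v. v \<in> space N \<Longrightarrow> (\<lambda>y. f y v) differentiable (at x)"
  shows "(\<lambda>v. gradient (\<lambda>y. f y v) x) \<in> borel_measurable N"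
proof (subst borel_measurable_euclidean_space, intro ballI)
  fix b :: 'a
  assume "b \<in> Basis"
  show "(\<lambda>v. gradient (\<lambda>y. f y v) x \<bullet> b) \<in> borel_measurable N"
  proof (rule borel_measurable_LIMSEQ_metric)
    show "(\<lambda>v. (f (x + inverse (real (Suc n)) *\<^sub>R b) v - f x v) * real (Suc n)) \<in> borel_measurable N" for n
      using meas by measurable
    show "(\<lambda>n. (f (x + inverse (real (Suc n)) *\<^sub>R b) v - f x v) * real (Suc n))
        \<longlonglongrightarrow> gradient (\<lambda>y. f y v) x \<bullet> b" if "v \<in> space N" for v
      using diff[OF that] by (intro GDERIV_difference_quotient GDERIV_gradient)
  qed
qed

text \<open>The constant \<open>indep_var\<close> requires both variables to have the same type, so independence is
assumed of \<open>U\<close> and \<open>V\<close> rather than of the scalar \<open>f \<circ> U\<close> and the vector \<open>g \<circ> V\<close>.\<close>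

lemma (in prob_space) indep_var_scaleR:
  fixes f :: "'c \<Rightarrow> real" and g :: "'c \<Rightarrow> 'b::euclidean_space"
  assumes indep: "indep_var N U N V"
    and [measurable]: "f \<in> borel_measurable N" "g \<in> borel_measurable N"
    and X: "integrable M (\<lambda>\<omega>. f (U \<omega>))" and Y: "integrable M (\<lambda>\<omega>. g (V \<omega>))"
  shows "integrable M (\<lambda>\<omega>. f (U \<omega>) *\<^sub>R g (V \<omega>))"
    and "(\<integral>\<omega>. f (U \<omega>) *\<^sub>R g (V \<omega>) \<partial>M) = expectation (\<lambda>\<omega>. f (U \<omega>)) *\<^sub>R (\<integral>\<omega>. g (V \<omega>) \<partial>M)"
proof -
  \<comment> \<open>Taking the inner product with \<open>b\<close> makes the second factor
    real-valued too, so that \<open>indep_var\<close> can be stated for the pair.\<close>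
  have indep_b: "indep_var borel (\<lambda>\<omega>. f (U \<omega>)) borel (\<lambda>\<omega>. g (V \<omega>) \<bullet> b)" for b
    using indep_var_compose[OF indep, of f borel "\<lambda>v. g v \<bullet> b" borel] by (simp add: o_def)
  have Y_b: "integrable M (\<lambda>\<omega>. g (V \<omega>) \<bullet> b)" for b
    using Y by (rule integrable_inner_left)
  have int: "integrable M (\<lambda>\<omega>. (f (U \<omega>) * (g (V \<omega>) \<bullet> b)) *\<^sub>R b)" for b
    by (intro integrable_scaleR_left indep_var_integrable indep_b X Y_b)
  \<comment> \<open>Expanding in the basis turns the vector-valued product into a finite sum of
    integrable scalar products times fixed vectors.\<close>
  have XY: "f (U \<omega>) *\<^sub>R g (V \<omega>) = (\<Sum>b\<in>Basis. (f (U \<omega>) * (g (V \<omega>) \<bullet> b)) *\<^sub>R b)" for \<omega>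
    by (subst euclidean_representation[of "g (V \<omega>)", symmetric])
      (simp only: scaleR_sum_right scaleR_scaleR)
  show int_XY: "integrable M (\<lambda>\<omega>. f (U \<omega>) *\<^sub>R g (V \<omega>))"
    unfolding XY by (intro Bochner_Integration.integrable_sum int)
  show "(\<integral>\<omega>. f (U \<omega>) *\<^sub>R g (V \<omega>) \<partial>M) = expectation (\<lambda>\<omega>. f (U \<omega>)) *\<^sub>R (\<integral>\<omega>. g (V \<omega>) \<partial>M)"
  proof (rule euclidean_eqI)
    fix b :: 'b
    assume "b \<in> Basis"
    have "(\<integral>\<omega>. f (U \<omega>) *\<^sub>R g (V \<omega>) \<partial>M) \<bullet> b = (\<integral>\<omega>. f (U \<omega>) * (g (V \<omega>) \<bullet> b) \<partial>M)"
      using integral_inner_left[OF int_XY, of b] by simp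
    also have "\<dots> = expectation (\<lambda>\<omega>. f (U \<omega>)) * ((\<integral>\<omega>. g (V \<omega>) \<partial>M) \<bullet> b)"
      using indep_var_lebesgue_integral[OF indep_b X Y_b] Y by simp
    finally show "(\<integral>\<omega>. f (U \<omega>) *\<^sub>R g (V \<omega>) \<partial>M) \<bullet> b = (expectation (\<lambda>\<omega>. f (U \<omega>)) *\<^sub>R (\<integral>\<omega>. g (V \<omega>) \<partial>M)) \<bullet> b"
      by simp
  qed
qed

theorem proposition4p2:
  fixes M :: "'w measure"
    and \<xi> \<xi>1 \<xi>2 :: "'w \<Rightarrow> real ^ 'd"
    and X :: "(real ^ 'n) set"
    and \<psi> :: "real ^ 'n \<Rightarrow> real ^ 'd \<Rightarrow> real"
    and \<Psi> :: "real ^ 'n \<Rightarrow> real"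
    and \<phi> :: "real \<Rightarrow> real"
    and \<phi>s :: "real \<Rightarrow> real \<Rightarrow> real"
    and fs :: "real ^ 'n \<Rightarrow> real \<Rightarrow> real"
    and G1 G2 :: real
  assumes "prob_space M"
    and "\<xi> \<in> borel_measurable M"
    and "\<And>x. \<psi> x \<in> borel_measurable borel"
    and "\<And>x v. (\<lambda>y. \<psi> y v) differentiable (at x)"
    and "\<And>x. integrable M (\<lambda>\<omega>. \<psi> x (\<xi> \<omega>))"
    and "\<And>x. \<Psi> x = (\<integral>\<omega>. \<psi> x (\<xi> \<omega>) \<partial>M)"
    and "\<And>x. \<Psi> differentiable (at x)"
    and "locally_lipschitz \<phi>"
    and "smoothing_function \<phi>s \<phi>"
    and "\<And>x \<mu>. fs x \<mu> = \<phi>s (\<Psi> x) \<mu>"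
    and "G1 > 0" and "G2 > 0"
    and "\<And>x. x \<in> X \<Longrightarrow>
           integrable M (\<lambda>\<omega>. (norm (gradient (\<lambda>y. \<psi> y (\<xi> \<omega>)) x))\<^sup>2) \<and>
           (\<integral>\<omega>. (norm (gradient (\<lambda>y. \<psi> y (\<xi> \<omega>)) x))\<^sup>2 \<partial>M) \<le> G1\<^sup>2"
    and "\<And>x \<mu>. x \<in> X \<Longrightarrow> \<mu> > 0 \<Longrightarrow>
           integrable M (\<lambda>\<omega>. (deriv (\<lambda>t. \<phi>s t \<mu>) (\<psi> x (\<xi> \<omega>)))\<^sup>2) \<and>
           (\<integral>\<omega>. (deriv (\<lambda>t. \<phi>s t \<mu>) (\<psi> x (\<xi> \<omega>)))\<^sup>2 \<partial>M) \<le> (G2 / \<mu>)\<^sup>2"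
    and "\<And>\<mu>. \<mu> > 0 \<Longrightarrow> \<exists>a b. \<forall>t. deriv (\<lambda>z. \<phi>s z \<mu>) t = a * t + b"
    and "independent_samples M \<xi> \<xi>1 \<xi>2"
    and "\<And>x. x \<in> X \<Longrightarrow> unbiased_estimator M (\<lambda>\<omega>. \<psi> x (\<xi>1 \<omega>)) (\<Psi> x)"
    and "\<And>x. x \<in> X \<Longrightarrow>
           unbiased_estimator M (\<lambda>\<omega>. gradient (\<lambda>y. \<psi> y (\<xi>2 \<omega>)) x) (gradient \<Psi> x)"
  shows "\<forall>x\<in>X. \<forall>\<mu>>0.
           (\<lambda>y. fs y \<mu>) differentiable (at x) \<and>
           unbiased_estimator M
             (\<lambda>\<omega>. deriv (\<lambda>t. \<phi>s t \<mu>) (\<psi> x (\<xi>1 \<omega>)) *\<^sub>R gradient (\<lambda>y. \<psi> y (\<xi>2 \<omega>)) x)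
             (gradient (\<lambda>y. fs y \<mu>) x)"
proof (intro ballI allI impI)
  fix x \<mu>
  assume x: "x \<in> X" and \<mu>: "(\<mu>::real) > 0"
  interpret prob_space M by fact
  \<comment> \<open>Slope and intercept may depend on \<open>\<mu>\<close>, which is fixed from here
    on.\<close>
  obtain a b where ab: "\<And>t. deriv (\<lambda>z. \<phi>s z \<mu>) t = a * t + b"
    using assms(15) \<mu> by blast
  define S where "S = (\<lambda>\<omega>. deriv (\<lambda>z. \<phi>s z \<mu>) (\<psi> x (\<xi>1 \<omega>)))"
  define T where "T = (\<lambda>\<omega>. gradient (\<lambda>y. \<psi> y (\<xi>2 \<omega>)) x)"

  have "(\<lambda>t. \<phi>s t \<mu>) differentiable (at (\<Psi> x))"
    using assms(9) \<mu> unfolding smoothing_function_def C1_differentiable_on_eq by simp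
  then have \<phi>s: "DERIV (\<lambda>t. \<phi>s t \<mu>) (\<Psi> x) :> deriv (\<lambda>z. \<phi>s z \<mu>) (\<Psi> x)"
    by (simp add: DERIV_deriv_iff_real_differentiable)
  \<comment> \<open>Chain rule, with the scalar derivative taken at the mean
    \<open>\<Psi> x\<close>.\<close>
  have GDERIV: "GDERIV (\<lambda>y. fs y \<mu>) x :> deriv (\<lambda>z. \<phi>s z \<mu>) (\<Psi> x) *\<^sub>R gradient \<Psi> x"
    unfolding assms(10) using GDERIV_gradient[OF assms(7)] \<phi>s by (rule GDERIV_DERIV_compose)

  have \<psi>1: "integrable M (\<lambda>\<omega>. \<psi> x (\<xi>1 \<omega>))" "(\<integral>\<omega>. \<psi> x (\<xi>1 \<omega>) \<partial>M) = \<Psi> x"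
    using assms(17)[OF x] by (simp_all add: unbiased_estimator_def)
  \<comment> \<open>Here linearity enters: the expectation of \<open>a * Y + b\<close> is
    \<open>a\<close> times that of \<open>Y\<close> plus \<open>b\<close>, the constant being
    preserved because the total mass is 1.\<close>
  then have S: "integrable M S" "expectation S = deriv (\<lambda>z. \<phi>s z \<mu>) (\<Psi> x)"
    by (simp_all add: S_def ab prob_space)
  have T: "integrable M T" "(\<integral>\<omega>. T \<omega> \<partial>M) = gradient \<Psi> x"
    using assms(18)[OF x] by (simp_all add: unbiased_estimator_def T_def)

  \<comment> \<open>Both factors are shown to be Borel functions of the sample value, so that
    independence of \<open>\<xi>1\<close> and \<open>\<xi>2\<close> carries over to them.\<close>
  have "(\<lambda>v. deriv (\<lambda>z. \<phi>s z \<mu>) (\<psi> x v)) \<in> borel_measurable borel"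
    unfolding ab using assms(3)[of x] by measurable
  moreover have "(\<lambda>v. gradient (\<lambda>y. \<psi> y v) x) \<in> borel_measurable borel"
    using assms(3,4) by (rule borel_measurable_gradient)
  moreover have "indep_var borel \<xi>1 borel \<xi>2"
    using assms(16) by (simp add: independent_samples_def)
  ultimately have "integrable M (\<lambda>\<omega>. S \<omega> *\<^sub>R T \<omega>)"
      "(\<integral>\<omega>. S \<omega> *\<^sub>R T \<omega> \<partial>M) = expectation S *\<^sub>R (\<integral>\<omega>. T \<omega> \<partial>M)"
    using indep_var_scaleR[of borel \<xi>1 \<xi>2] S(1) T(1) unfolding S_def T_def by blast+
  then have "unbiased_estimator M (\<lambda>\<omega>. S \<omega> *\<^sub>R T \<omega>) (gradient (\<lambda>y. fs y \<mu>) x)"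
    using S(2) T(2) gradient_eqI[OF GDERIV] by (simp add: unbiased_estimator_def)
  \<comment> \<open>Differentiability guarantees that \<open>gradient\<close> denotes an actual
    gradient here rather than an unspecified value.\<close>
  moreover have "(\<lambda>y. fs y \<mu>) differentiable (at x)"
    using GDERIV unfolding gderiv_def by (rule differentiableI)
  ultimately show "(\<lambda>y. fs y \<mu>) differentiable (at x) \<and>
      unbiased_estimator M
        (\<lambda>\<omega>. deriv (\<lambda>t. \<phi>s t \<mu>) (\<psi> x (\<xi>1 \<omega>)) *\<^sub>R gradient (\<lambda>y. \<psi> y (\<xi>2 \<omega>)) x)
        (gradient (\<lambda>y. fs y \<mu>) x)"
    unfolding S_def T_def by blast
qed

end
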